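(* Let $r>1$ be a rational number, and for $c\in\mathbb{R}$ let $f_c:\mathbb{R}\to\mathbb{R}$, $f_c(x)=|x|^r+c$. Let $(c,n)$ be a periodic pair, i.e. $c\in\mathbb{R}$ and $n\geq 1$ is an integer such that $f_c^n(0)=0$ and $f_c^j(0)\neq 0$ for all integers $j\in[1,n-1]$. Then $D_c(f_c^n(0))\neq 0$.
   Context: $f_c^n$ denotes the $n$-fold iterate of $f_c$ (composition with itself $n$ times). For fixed $r$ and $n$, $D_c(f_c^n(0))$ denotes the derivative, evaluated at the given parameter $c$, of the real function $t\mapsto f_t^n(0)$ of the parameter $t\in\mathbb{R}$, where $f_t(x)=|x|^r+t$. *)

theory Defs
  imports "HOL-Analysis.Analysis"
begin

text \<open>In HOL, \<^term>\<open>0 powr r = (0::real)\<close>, so this is the usual \<open>|x|\<^sup>r\<close> also at \<open>x = 0\<close>.\<close>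

definition power_map :: "real \<Rightarrow> real \<Rightarrow> real \<Rightarrow> real" where
  "power_map r c x = \<bar>x\<bar> powr r + c"

definition periodic_pair :: "real \<Rightarrow> real \<Rightarrow> nat \<Rightarrow> bool" where
  "periodic_pair r c n \<longleftrightarrow>
     n \<ge> 1 \<and> (power_map r c ^^ n) 0 = 0 \<and> (\<forall>j\<in>{1..n-1}. (power_map r c ^^ j) 0 \<noteq> 0)"

text \<open>The derivative with respect to the parameter exists everywhere when \<open>r > 1\<close>, so
  \<^const>\<open>deriv\<close>, an unspecified value where a function is not differentiable, is the
  genuine derivative in \<open>param_deriv\<close>.\<close>

definition param_deriv :: "real \<Rightarrow> nat \<Rightarrow> real \<Rightarrow> real" where
  "param_deriv r n c = deriv (\<lambda>t. (power_map r t ^^ n) 0) c"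

lemma has_real_derivative_abs_powr:
  fixes r x :: real
  assumes "r > 1"
  shows "((\<lambda>x. \<bar>x\<bar> powr r) has_real_derivative r * sgn x * \<bar>x\<bar> powr (r - 1)) (at x)"
proof (cases "x = 0")
  case True
  have "((\<lambda>h::real. \<bar>h\<bar> powr (r - 1)) \<longlongrightarrow> \<bar>0\<bar> powr (r - 1)) (at 0)"
    using assms by (intro tendsto_powr' tendsto_rabs tendsto_ident_at tendsto_const) auto
  then have lim: "((\<lambda>h::real. \<bar>h\<bar> powr (r - 1)) \<longlongrightarrow> 0) (at 0)"
    by simp
  have "((\<lambda>h::real. \<bar>h\<bar> powr r / h) \<longlongrightarrow> 0) (at 0)"
  proof (rule Lim_null_comparison[OF _ lim])
    show "\<forall>\<^sub>F h in at (0::real). norm (\<bar>h\<bar> powr r / h) \<le> \<bar>h\<bar> powr (r - 1)"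
      by (auto simp: eventually_at_filter powr_diff)
  qed
  then show ?thesis
    using True by (simp add: DERIV_def)
next
  case False
  have "(abs has_real_derivative sgn x) (at x)"
  proof (cases "x > 0")
    case True
    then have "((\<lambda>y. y) has_real_derivative sgn x) (at x)"
      by (auto intro!: derivative_eq_intros)
    then show ?thesis
      by (rule has_field_derivative_transform_within_open[where S = "{0<..}"]) (use True in auto)
  next
    case nonpos: False
    then have "((\<lambda>y. - y) has_real_derivative sgn x) (at x)"
      using False by (auto intro!: derivative_eq_intros)
    then show ?thesis
      by (rule has_field_derivative_transform_within_open[where S = "{..<0}"])
        (use False nonpos in auto)
  qed
  then show ?thesis
    using False by (auto intro!: derivative_eq_intros simp: powr_diff)
qed

lemma iterate_differentiable:
  assumes "r > 1"
  shows "(\<lambda>t. (power_map r t ^^ n) 0) differentiable (at c)"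
proof (induction n)
  case 0
  then show ?case by simp
next
  case (Suc n)
  then obtain d where "((\<lambda>t. (power_map r t ^^ n) 0) has_real_derivative d) (at c)"
    by (auto simp: real_differentiable_def)
  from DERIV_add[OF DERIV_chain2[OF has_real_derivative_abs_powr[OF assms] this] DERIV_ident]
  have "\<exists>d. ((\<lambda>t. \<bar>(power_map r t ^^ n) 0\<bar> powr r + t) has_real_derivative d) (at c)"
    by blast
  moreover have "(\<lambda>t. (power_map r t ^^ Suc n) 0) = (\<lambda>t. \<bar>(power_map r t ^^ n) 0\<bar> powr r + t)"
    by (rule ext) (simp add: power_map_def)
  ultimately show ?case
    by (simp only: real_differentiable_def)
qed

lemma has_real_derivative_iterate:
  assumes "r > 1"
  shows "((\<lambda>t. (power_map r t ^^ n) 0) has_real_derivative param_deriv r n c) (at c)"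
  using iterate_differentiable[OF assms, of n c]
  unfolding param_deriv_def by (metis DERIV_imp_deriv real_differentiable_def)

end

theory Submission
  imports Defs
begin

text \<open>
  The proof is arithmetic, in the spirit of Gleason's argument for \<open>x\<^sup>2 + c\<close>. Write
  \<open>x\<^sub>j = f\<^sub>c\<^sup>j(0)\<close> and \<open>D\<^sub>j = D\<^sub>c(f\<^sub>c\<^sup>j(0))\<close>. The chain rule gives \<open>D\<^sub>0 = 0\<close> and
  \<open>D\<^sub>j\<^sub>+\<^sub>1 = 1 + r sgn(x\<^sub>j) |x\<^sub>j|\<^sup>r\<^sup>-\<^sup>1 D\<^sub>j\<close>. Let \<open>r = p / q\<close> in lowest terms and let \<open>l\<close> be
  a prime divisor of \<open>p\<close>, so that \<open>r\<close> is divisible by \<open>l\<close> in the \<open>l\<close>-adic sense. If all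
  \<open>x\<^sub>j\<close> are \<open>l\<close>-adically integral, then so are the numbers \<open>|x\<^sub>j|\<^sup>r\<^sup>-\<^sup>1\<close>, which are
  nonnegative integral powers of \<open>q\<close>-th roots of \<open>|x\<^sub>j|\<close>; hence \<open>D\<^sub>n\<close> is congruent to
  \<open>1\<close> modulo \<open>l\<close>, and in particular nonzero.

  The \<open>l\<close>-adic valuation of the rationals extends to the whole field of real numbers, so it
  does not matter whether \<open>c\<close> is algebraic. Only the valuation ring of the extension is
  used: a subring \<open>A\<close> of the reals that contains \<open>x\<close> or \<open>1/x\<close> for each real \<open>x\<close> and does not
  contain \<open>1/l\<close>. A subring maximal among those that avoid \<open>1/l\<close> is one
  (\<open>valuation_ring_excluding_inverse\<close>).

  The orbit is integral because it is periodic. If \<open>c\<close> were not in \<open>A\<close>, that is, of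
  absolute value greater than \<open>1\<close>, then \<open>|x|\<^sup>r\<close> would dominate \<open>c\<close> whenever \<open>x\<close> is at
  least as large as \<open>c\<close>. So all \<open>x\<^sub>j\<close> with \<open>j \<ge> 1\<close> would be at least as large as \<open>c\<close>, and
  none of them could vanish (\<open>orbit_escapes\<close>).
\<close>

section \<open>Subrings of a field\<close>

locale field_subring =
  fixes A :: "'a::field set"
  assumes one_mem [simp, intro]: "1 \<in> A"
    and diff_mem [intro]: "x \<in> A \<Longrightarrow> y \<in> A \<Longrightarrow> x - y \<in> A"
    and mult_mem [intro]: "x \<in> A \<Longrightarrow> y \<in> A \<Longrightarrow> x * y \<in> A"
begin

lemma zero_mem [simp, intro]: "0 \<in> A"
  using diff_mem[OF one_mem one_mem] by simp

lemma uminus_mem [intro]: "x \<in> A \<Longrightarrow> - x \<in> A"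
  using diff_mem[OF zero_mem] by simp

lemma add_mem [intro]: "x \<in> A \<Longrightarrow> y \<in> A \<Longrightarrow> x + y \<in> A"
  using diff_mem[OF _ uminus_mem, of x y] by simp

lemma power_mem [intro]: "x \<in> A \<Longrightarrow> x ^ n \<in> A"
  by (induction n) auto

lemma sum_mem [intro]: "(\<And>i. i \<in> I \<Longrightarrow> g i \<in> A) \<Longrightarrow> sum g I \<in> A"
  by (induction I rule: infinite_finite_induct) auto

lemma of_nat_mem [simp, intro]: "of_nat n \<in> A"
  by (induction n) auto

lemma of_int_mem [simp, intro]: "of_int k \<in> A"
  by (cases k rule: int_cases2) auto

definition adjoin :: "'a \<Rightarrow> 'a set" where
  "adjoin x = {poly p x | p. \<forall>i. coeff p i \<in> A}"

lemma field_subring_adjoin: "field_subring (adjoin x)"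
proof
  show "1 \<in> adjoin x"
    unfolding adjoin_def by (rule CollectI, rule exI[of _ 1]) (auto simp: coeff_1)
next
  fix y z assume "y \<in> adjoin x" "z \<in> adjoin x"
  then obtain p s where *: "y = poly p x" "z = poly s x"
    "\<And>i. coeff p i \<in> A" "\<And>i. coeff s i \<in> A"
    unfolding adjoin_def by auto
  show "y - z \<in> adjoin x"
    unfolding adjoin_def using * by (intro CollectI exI[of _ "p - s"]) auto
  show "y * z \<in> adjoin x"
    unfolding adjoin_def using * by (intro CollectI exI[of _ "p * s"]) (auto simp: coeff_mult)
qed

lemma subset_adjoin: "A \<subseteq> adjoin x"
proof
  fix y assume "y \<in> A"
  then show "y \<in> adjoin x"
    unfolding adjoin_def
    by (intro CollectI exI[of _ "[:y:]"]) (auto simp: coeff_pCons split: nat.splits)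
qed

lemma mem_adjoin: "x \<in> adjoin x"
  unfolding adjoin_def
  by (intro CollectI exI[of _ "[:0, 1:]"]) (auto simp: coeff_pCons split: nat.splits)

lemma adjoin_eq_sum:
  assumes "y \<in> adjoin x"
  obtains N a where "\<And>i. a i \<in> A" and "y = (\<Sum>i\<le>N. a i * x ^ i)"
  using assms unfolding adjoin_def by (auto simp: poly_altdef)

end

section \<open>Valuation rings\<close>

text \<open>An element with a nonintegral inverse is one of absolute value less than \<open>1\<close> for the
  valuation belonging to \<open>A\<close>; these elements, with \<open>0\<close>, are the maximal ideal.\<close>

locale valuation_ring = field_subring +
  assumes mem_or_inverse_mem: "x \<in> A \<or> inverse x \<in> A"
begin

definition small :: "'a set" where
  "small = {t \<in> A. t = 0 \<or> inverse t \<notin> A}"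

lemma small_mem: "t \<in> small \<Longrightarrow> t \<in> A"
  by (simp add: small_def)

lemma inverse_small: "y \<notin> A \<Longrightarrow> inverse y \<in> small"
  using mem_or_inverse_mem[of y] by (auto simp: small_def)

lemma mult_small:
  assumes "s \<in> A" and "t \<in> small"
  shows "s * t \<in> small"
proof -
  have "inverse (s * t) \<notin> A" if "s * t \<noteq> 0"
  proof
    assume "inverse (s * t) \<in> A"
    then have "s * inverse (s * t) \<in> A"
      using assms by blast
    then show False
      using that assms(2) by (auto simp: small_def field_simps)
  qed
  then show ?thesis
    using assms by (auto simp: small_def)
qed

text \<open>The ultrametric inequality: an element of absolute value less than \<open>1\<close> does not change
  the absolute value of \<open>1\<close> when added to it.\<close>

lemma one_plus_small:
  assumes "t \<in> small"
  shows "1 + t \<noteq> 0" and "inverse (1 + t) \<in> A"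
proof -
  show nz: "1 + t \<noteq> 0"
  proof
    assume "1 + t = 0"
    then have "t = - 1"
      by (simp add: add_eq_0_iff)
    then show False
      using assms by (auto simp: small_def)
  qed
  show "inverse (1 + t) \<in> A"
  proof (cases "t = 0")
    case False
    \<comment> \<open>The two candidates for membership are \<open>1 - 1/(1 + t)\<close> and its inverse \<open>1 + 1/t\<close>.\<close>
    from mem_or_inverse_mem[of "1 - inverse (1 + t)"] show ?thesis
    proof
      assume "1 - inverse (1 + t) \<in> A"
      from diff_mem[OF one_mem this] show ?thesis by simp
    next
      assume *: "inverse (1 - inverse (1 + t)) \<in> A"
      have "1 - inverse (1 + t) = t / (1 + t)"
        using nz by (simp add: field_simps)
      then have "inverse (1 - inverse (1 + t)) - 1 = inverse t"
        using nz False by (simp add: field_simps)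
      then have "inverse t \<in> A"
        using diff_mem[OF * one_mem] by simp
      then show ?thesis
        using False assms by (auto simp: small_def)
    qed
  qed auto
qed

lemma root_mem:
  assumes "y ^ q \<in> A" and "q > 0"
  shows "y \<in> A"
proof (rule ccontr)
  assume y: "y \<notin> A"
  then have "inverse y \<in> A" and "y \<noteq> 0"
    using mem_or_inverse_mem[of y] by auto
  then have "y ^ q * inverse y ^ (q - 1) \<in> A"
    using assms(1) by blast
  moreover have "y ^ q * inverse y ^ (q - 1) = y"
    using \<open>y \<noteq> 0\<close> \<open>q > 0\<close> by (cases q) (auto simp: field_simps)
  ultimately show False
    using y by simp
qed

end

section \<open>Existence of valuation rings\<close>

locale maximal_subring_excluding_inverse = field_subring +
  fixes l :: 'a
  assumes l_mem: "l \<in> A"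
    and inverse_notin: "inverse l \<notin> A"
    and maximal: "field_subring B \<Longrightarrow> A \<subseteq> B \<Longrightarrow> inverse l \<notin> B \<Longrightarrow> B = A"
begin

lemma not_unit: "a \<in> A \<Longrightarrow> l * a \<noteq> 1"
  using inverse_notin inverse_unique by metis

text \<open>Adjoining a new element \<open>x\<close> must bring \<open>1/l\<close> into the ring, by maximality.\<close>

lemma inverse_mem_adjoin:
  assumes "x \<notin> A"
  obtains N a where "\<And>i. a i \<in> A" and "l * (\<Sum>i\<le>N. a i * x ^ i) = 1"
proof -
  have "adjoin x \<noteq> A"
    using assms mem_adjoin by blast
  then have "inverse l \<in> adjoin x"
    using maximal[OF field_subring_adjoin subset_adjoin] by blast
  then obtain N a where a: "\<And>i. a i \<in> A" "inverse l = (\<Sum>i\<le>N. a i * x ^ i)"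
    by (rule adjoin_eq_sum) blast
  moreover have "l \<noteq> 0"
    using inverse_notin by auto
  ultimately show thesis
    using that by (metis right_inverse)
qed

lemma unit_minus_multiple:
  assumes b: "b \<in> A"
  shows "inverse (1 - l * b) \<in> A"
proof (rule ccontr)
  define u where "u = 1 - l * b"
  assume "inverse (1 - l * b) \<notin> A"
  then have notin: "inverse u \<notin> A"
    by (simp add: u_def)
  then have "u \<noteq> 0"
    by auto
  have "u \<in> A"
    using l_mem b by (auto simp: u_def)
  from notin obtain N a where a: "\<And>i. a i \<in> A"
    and eq: "l * (\<Sum>i\<le>N. a i * inverse u ^ i) = 1"
    by (rule inverse_mem_adjoin) blast
  \<comment> \<open>Multiplied by \<open>u\<^sup>N\<close>, the equation says that \<open>u\<^sup>N\<close> is divisible by \<open>l\<close>, although \<open>u\<close> and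
    all its powers are congruent to \<open>1\<close> modulo \<open>l\<close>.\<close>
  have "u ^ N = l * (\<Sum>i\<le>N. a i * inverse u ^ i) * u ^ N"
    using eq by simp
  also have "\<dots> = l * (\<Sum>i\<le>N. a i * u ^ (N - i))"
    unfolding mult.assoc sum_distrib_right
    using \<open>u \<noteq> 0\<close> by (intro arg_cong[where f = "(*) l"] sum.cong)
      (auto simp: power_diff field_simps)
  finally have 1: "u ^ N = l * (\<Sum>i\<le>N. a i * u ^ (N - i))" .
  have "\<exists>d\<in>A. u ^ k = 1 - l * d" for k
  proof (induction k)
    case 0
    then show ?case by (intro bexI[of _ 0]) auto
  next
    case (Suc k)
    then obtain d where "d \<in> A" "u ^ k = 1 - l * d" by blast
    then have "u ^ Suc k = 1 - l * (d + b * u ^ k)"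
      by (simp add: u_def algebra_simps)
    then show ?case
      using \<open>d \<in> A\<close> b \<open>u \<in> A\<close> by blast
  qed
  then obtain d where "d \<in> A" "u ^ N = 1 - l * d" by blast
  then have "l * ((\<Sum>i\<le>N. a i * u ^ (N - i)) + d) = 1"
    using 1 by (simp add: algebra_simps)
  moreover have "(\<Sum>i\<le>N. a i * u ^ (N - i)) + d \<in> A"
    using a \<open>d \<in> A\<close> \<open>u \<in> A\<close> by blast
  ultimately show False
    using not_unit by blast
qed

definition inverse_degree_le :: "'a \<Rightarrow> nat \<Rightarrow> bool" where
  "inverse_degree_le x N \<longleftrightarrow> (\<exists>a. (\<forall>i. a i \<in> A) \<and> l * (\<Sum>i\<le>N. a i * x ^ i) = 1)"

lemma inverse_degree_le_mono:
  assumes "inverse_degree_le x M" and "M \<le> N"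
  shows "inverse_degree_le x N"
proof -
  obtain a where a: "\<And>i. a i \<in> A" "l * (\<Sum>i\<le>M. a i * x ^ i) = 1"
    using assms(1) unfolding inverse_degree_le_def by blast
  have "(\<Sum>i\<le>N. (if i \<le> M then a i else 0) * x ^ i) = (\<Sum>i\<le>M. a i * x ^ i)"
    using assms(2) by (intro sum.mono_neutral_cong_right) auto
  then show ?thesis
    unfolding inverse_degree_le_def using a
    by (intro exI[of _ "\<lambda>i. if i \<le> M then a i else 0"]) auto
qed

text \<open>If \<open>1/l\<close> is a polynomial in \<open>x\<close> and also one in \<open>1/x\<close>, the second expression makes \<open>1\<close>
  a combination of strictly negative powers of \<open>x\<close>, because \<open>1 - l b\<^sub>0\<close> is a unit for its constant
  term \<open>b\<^sub>0\<close>. Multiplication by a power of \<open>x\<close> then rewrites the leading power of \<open>x\<close> in the first expression by lower ones.\<close>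

lemma inverse_degree_le_reduce:
  assumes x: "x \<noteq> 0"
    and "inverse_degree_le x (Suc N)"
    and "inverse_degree_le (inverse x) (Suc N)"
  shows "inverse_degree_le x N"
proof -
  obtain a where a: "\<And>i. a i \<in> A" "l * (\<Sum>i\<le>Suc N. a i * x ^ i) = 1"
    using assms(2) unfolding inverse_degree_le_def by blast
  obtain b where b: "\<And>i. b i \<in> A" "l * (\<Sum>i\<le>Suc N. b i * inverse x ^ i) = 1"
    using assms(3) unfolding inverse_degree_le_def by blast
  define v where "v = inverse (1 - l * b 0)"
  have v: "v \<in> A"
    unfolding v_def using b(1) by (rule unit_minus_multiple)
  have v1: "v * (1 - l * b 0) = 1"
    unfolding v_def using not_unit[OF b(1), of 0] by simp
  have "(\<Sum>i\<le>Suc N. b i * inverse x ^ i) = b 0 + (\<Sum>i\<le>N. b (Suc i) * inverse x ^ Suc i)"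
    by (subst sum.atMost_Suc_shift) simp
  then have *: "1 - l * b 0 = l * (\<Sum>i\<le>N. b (Suc i) * inverse x ^ Suc i)"
    using b(2) by (simp add: algebra_simps)
  have "x ^ Suc N = v * (1 - l * b 0) * x ^ Suc N"
    by (simp add: v1)
  also have "\<dots> = v * l * (\<Sum>i\<le>N. b (Suc i) * inverse x ^ Suc i * x ^ Suc N)"
    by (simp only: * sum_distrib_right mult.assoc)
  also have "(\<Sum>i\<le>N. b (Suc i) * inverse x ^ Suc i * x ^ Suc N)
      = (\<Sum>i\<le>N. b (Suc i) * x ^ (N - i))"
    using x by (intro sum.cong) (auto simp: power_diff field_simps)
  also have "\<dots> = (\<Sum>i\<le>N. b (Suc (N - i)) * x ^ i)"
    by (subst sum.nat_diff_reindex[where n = "Suc N", unfolded lessThan_Suc_atMost, symmetric]) simp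
  finally have lead: "x ^ Suc N = v * l * (\<Sum>i\<le>N. b (Suc (N - i)) * x ^ i)" .
  have "(\<Sum>i\<le>N. (a i + a (Suc N) * v * l * b (Suc (N - i))) * x ^ i)
      = (\<Sum>i\<le>N. a i * x ^ i) + a (Suc N) * (v * l * (\<Sum>i\<le>N. b (Suc (N - i)) * x ^ i))"
    by (simp add: sum.distrib sum_distrib_left algebra_simps)
  also have "\<dots> = (\<Sum>i\<le>Suc N. a i * x ^ i)"
    by (simp only: lead[symmetric] sum.atMost_Suc)
  finally have "l * (\<Sum>i\<le>N. (a i + a (Suc N) * v * l * b (Suc (N - i))) * x ^ i) = 1"
    using a(2) by simp
  then show ?thesis
    unfolding inverse_degree_le_def using a(1) b(1) v l_mem
    by (intro exI[of _ "\<lambda>i. a i + a (Suc N) * v * l * b (Suc (N - i))"]) blast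
qed

text \<open>A common bound on the two degrees makes the situation symmetric in \<open>x\<close> and \<open>1/x\<close>, so that
  both expressions can be shortened at once, down to constants.\<close>

lemma not_inverse_degree_le_both:
  assumes "x \<noteq> 0"
  shows "\<not> (inverse_degree_le x N \<and> inverse_degree_le (inverse x) N)"
proof (induction N)
  case 0
  then show ?case
    using not_unit by (auto simp: inverse_degree_le_def)
next
  case (Suc N)
  then show ?case
    using inverse_degree_le_reduce[of x N] inverse_degree_le_reduce[of "inverse x" N] assms
    by auto
qed

sublocale valuation_ring
proof
  fix x
  show "x \<in> A \<or> inverse x \<in> A"
  proof (rule ccontr)
    assume neg: "\<not> (x \<in> A \<or> inverse x \<in> A)"
    then have "x \<noteq> 0" by auto
    obtain M where M: "inverse_degree_le x M"
      using neg inverse_mem_adjoin[of x] unfolding inverse_degree_le_def by metis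
    obtain N where N: "inverse_degree_le (inverse x) N"
      using neg inverse_mem_adjoin[of "inverse x"] unfolding inverse_degree_le_def by metis
    show False
      using not_inverse_degree_le_both[OF \<open>x \<noteq> 0\<close>, of "max M N"]
        inverse_degree_le_mono[OF M] inverse_degree_le_mono[OF N] by simp
  qed
qed

end

lemma field_subring_Union_chain:
  assumes "C \<noteq> {}" and chain: "subset.chain {B. field_subring B} C"
  shows "field_subring (\<Union>C)"
proof
  have sub: "field_subring B" if "B \<in> C" for B
    using chain that by (auto simp: subset.chain_def)
  show "1 \<in> \<Union>C"
    using \<open>C \<noteq> {}\<close> sub field_subring.one_mem by blast
  fix x y assume "x \<in> \<Union>C" "y \<in> \<Union>C"
  then obtain B where B: "B \<in> C" "x \<in> B" "y \<in> B"
    using chain by (auto simp: subset_chain_def) blast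
  interpret field_subring B by (rule sub[OF B(1)])
  show "x - y \<in> \<Union>C" "x * y \<in> \<Union>C"
    using B by blast+
qed

text \<open>This is the existence theorem for extensions of valuations, in the form that an element
  that is not a unit of some subring remains a nonunit in some valuation ring.\<close>

theorem valuation_ring_excluding_inverse:
  fixes l :: "'a::field"
  assumes "field_subring R" and "l \<in> R" and "inverse l \<notin> R"
  obtains A where "valuation_ring A" and "R \<subseteq> A" and "inverse l \<notin> A"
proof -
  define S where "S = {B. field_subring B \<and> R \<subseteq> B \<and> inverse l \<notin> B}"
  have "\<exists>A\<in>S. \<forall>B\<in>S. A \<subseteq> B \<longrightarrow> B = A"
  proof (rule subset_Zorn_nonempty)
    show "S \<noteq> {}"
      using assms by (auto simp: S_def)
    fix C assume C: "C \<noteq> {}" "subset.chain S C"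
    then have "subset.chain {B. field_subring B} C"
      by (auto simp: subset.chain_def S_def)
    then have "field_subring (\<Union>C)"
      using C(1) field_subring_Union_chain by blast
    then show "\<Union>C \<in> S"
      using C by (auto simp: subset.chain_def S_def)
  qed
  then obtain A where A: "A \<in> S" and max: "\<And>B. B \<in> S \<Longrightarrow> A \<subseteq> B \<Longrightarrow> B = A"
    by blast
  have "maximal_subring_excluding_inverse A l"
    using A max assms(2)
    by (auto simp: S_def maximal_subring_excluding_inverse_def
        maximal_subring_excluding_inverse_axioms_def)
  then interpret maximal_subring_excluding_inverse A l .
  show thesis
    using that[OF valuation_ring_axioms] A by (auto simp: S_def)
qed

corollary valuation_ring_over_prime:
  fixes l :: nat
  assumes "prime l"
  obtains A :: "'a::field_char_0 set"
  where "valuation_ring A" and "inverse (of_nat l) \<notin> A"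
proof (rule valuation_ring_excluding_inverse)
  show "field_subring (\<int> :: 'a set)"
    by unfold_locales auto
  show "of_nat l \<in> (\<int> :: 'a set)"
    by auto
  show "inverse (of_nat l) \<notin> (\<int> :: 'a set)"
  proof
    assume "inverse (of_nat l) \<in> (\<int> :: 'a set)"
    then obtain k where "inverse (of_nat l) = (of_int k :: 'a)"
      by (auto elim: Ints_cases)
    then have "(of_int (int l * k) :: 'a) = of_int 1"
      using prime_gt_0_nat[OF assms] by (simp flip: \<open>inverse _ = _\<close>)
    then have "int l * k = 1"
      by (simp only: of_int_eq_iff)
    then show False
      using prime_gt_1_nat[OF assms] by (auto simp: zmult_eq_1_iff)
  qed
qed (use that in auto)

section \<open>The critical orbit in a valuation ring\<close>

lemma abs_powr_rational:
  fixes x :: real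
  assumes "q > 0"
  obtains y where "y ^ q = \<bar>x\<bar>" and "\<And>k. k > 0 \<Longrightarrow> \<bar>x\<bar> powr (real k / real q) = y ^ k"
proof
  show "root q \<bar>x\<bar> ^ q = \<bar>x\<bar>"
    using assms by simp
  fix k :: nat assume "k > 0"
  show "\<bar>x\<bar> powr (real k / real q) = root q \<bar>x\<bar> ^ k"
  proof (cases "x = 0")
    case False
    then have "root q \<bar>x\<bar> = \<bar>x\<bar> powr (1 / real q)"
      using assms by (simp add: root_powr_inverse)
    then show ?thesis
      using False by (simp add: powr_powr flip: powr_realpow)
  qed (use \<open>k > 0\<close> in auto)
qed

lemma param_deriv_0: "param_deriv r 0 c = 0"
  by (simp add: param_deriv_def)

lemma param_deriv_Suc:
  fixes r c :: real and n :: nat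
  assumes "r > 1"
  defines "x \<equiv> (power_map r c ^^ n) 0"
  shows "param_deriv r (Suc n) c
    = 1 + r * sgn x * \<bar>x\<bar> powr (r - 1) * param_deriv r n c"
proof -
  have "((\<lambda>t. \<bar>(power_map r t ^^ n) 0\<bar> powr r + t) has_real_derivative
      r * sgn x * \<bar>x\<bar> powr (r - 1) * param_deriv r n c + 1) (at c)"
    unfolding x_def
    by (rule DERIV_add[OF DERIV_chain2[OF has_real_derivative_abs_powr[OF assms(1)]
          has_real_derivative_iterate[OF assms(1)]] DERIV_ident])
  then have "((\<lambda>t. (power_map r t ^^ Suc n) 0) has_real_derivative
      r * sgn x * \<bar>x\<bar> powr (r - 1) * param_deriv r n c + 1) (at c)"
    by (simp add: power_map_def)
  then show ?thesis
    using DERIV_unique[OF has_real_derivative_iterate[OF assms(1)]] by fastforce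
qed

locale real_valuation_ring = valuation_ring A for A :: "real set"
begin

lemma abs_mem_iff [simp]: "\<bar>x\<bar> \<in> A \<longleftrightarrow> x \<in> A"
  using uminus_mem[of x] uminus_mem[of "- x"] by (auto simp: abs_if)

lemma sgn_mem [simp]: "sgn x \<in> A"
  by (auto simp: sgn_if)

lemma abs_powr_mem:
  assumes "x \<in> A" and "k > 0" and "q > 0"
  shows "\<bar>x\<bar> powr (real k / real q) \<in> A"
proof -
  obtain y where y: "y ^ q = \<bar>x\<bar>" "\<bar>x\<bar> powr (real k / real q) = y ^ k"
    using abs_powr_rational[OF \<open>q > 0\<close>] \<open>k > 0\<close> by metis
  then have "y \<in> A"
    using root_mem[OF _ \<open>q > 0\<close>] assms(1) by simp
  then show ?thesis
    using y(2) by auto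
qed

text \<open>The invariant \<open>c / x \<in> A\<close> says that \<open>x\<close> is at least as large as \<open>c\<close>. As \<open>c\<close> has absolute
  value greater than \<open>1\<close> and \<open>r > 1\<close>, the term \<open>c\<close> is then small compared with \<open>|x|\<^sup>r\<close>.\<close>

lemma escape_step:
  fixes c x :: real and p q :: nat
  assumes c: "c \<notin> A" and q: "0 < q" "q < p"
    and x: "x \<noteq> 0" "c / x \<in> A"
  defines "x' \<equiv> power_map (real p / real q) c x"
  shows "x' \<noteq> 0 \<and> c / x' \<in> A"
proof -
  obtain y where y: "y ^ q = \<bar>x\<bar>" "\<bar>x\<bar> powr (real p / real q) = y ^ p"
    using abs_powr_rational[OF \<open>0 < q\<close>] q by (metis less_trans)
  have "x \<notin> A"
    using c x mult_mem[of "c / x" x] by auto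
  then have "y \<notin> A"
    using y(1) power_mem[of y q] by auto
  then have "y \<noteq> 0"
    by auto
  define t where "t = c / y ^ p"
  have "t = sgn x * (c / x) * inverse y ^ (p - q)"
  proof -
    have "y ^ p = \<bar>x\<bar> * y ^ (p - q)"
      using q by (simp flip: y(1) power_add)
    then show ?thesis
      unfolding t_def using x(1) \<open>y \<noteq> 0\<close> by (auto simp: field_simps sgn_if abs_if)
  qed
  also have "\<dots> = sgn x * (c / x) * inverse y ^ (p - q - 1) * inverse y"
    using q by (simp add: power_eq_if)
  also have "\<dots> \<in> small"
    using x(2) inverse_small[OF \<open>y \<notin> A\<close>]
    by (intro mult_small mult_mem power_mem sgn_mem) (auto intro: small_mem)
  finally have t: "t \<in> small" .
  have x': "x' = y ^ p * (1 + t)"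
    using y(2) \<open>y \<noteq> 0\<close> by (simp add: x'_def power_map_def t_def field_simps)
  then have "c / x' = t * inverse (1 + t)"
    by (simp add: t_def divide_inverse mult_ac)
  then show ?thesis
    using x' \<open>y \<noteq> 0\<close> one_plus_small[OF t] small_mem[OF t] by auto
qed

lemma orbit_escapes:
  assumes c: "c \<notin> A" and q: "0 < q" "q < p"
  shows "(power_map (real p / real q) c ^^ Suc n) 0 \<noteq> 0"
proof -
  let ?f = "power_map (real p / real q) c"
  have "(?f ^^ Suc n) 0 \<noteq> 0 \<and> c / (?f ^^ Suc n) 0 \<in> A"
  proof (induction n)
    case 0
    have "c \<noteq> 0"
      using c by auto
    then show ?case
      by (simp add: power_map_def)
  next
    case (Suc n)
    then show ?case
      using escape_step[OF c q, of "(?f ^^ Suc n) 0"] by simp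
  qed
  then show ?thesis ..
qed

lemma orbit_mem:
  assumes "c \<in> A" and "0 < q" "0 < p"
  shows "(power_map (real p / real q) c ^^ n) 0 \<in> A"
  using assms abs_powr_mem by (induction n) (auto simp: power_map_def)

text \<open>In a valuation ring where \<open>l\<close> is not a unit, every integer prime to \<open>l\<close> is a unit, by
  Bezout's identity.\<close>

lemma inverse_of_nat_mem:
  assumes "real l \<in> small" and "coprime l q"
  shows "inverse (real q) \<in> A"
proof -
  obtain a b where "a * int l + b * int q = 1"
    using assms(2) bezout_int[of "int l" "int q"] by (auto simp: coprime_iff_gcd_eq_1 gcd_int_int_eq)
  then have "real_of_int (a * int l + b * int q) = 1"
    by (simp only: of_int_1)
  then have ab: "of_int b * real q = 1 + of_int (- a) * real l"
    by simp
  have s: "of_int (- a) * real l \<in> small"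
    using assms(1) by (intro mult_small of_int_mem)
  have "real q \<noteq> 0"
    using ab one_plus_small(1)[OF s] by (metis mult_zero_right)
  then have "inverse (real q) = of_int b * inverse (of_int b * real q)"
    using ab one_plus_small(1)[OF s] by (auto simp: field_simps)
  then show ?thesis
    unfolding ab using one_plus_small(2)[OF s] by auto
qed

text \<open>The exponent \<open>r\<close> lies in the maximal ideal because its numerator is divisible by \<open>l\<close> and
  its denominator is not. Hence each step of the recursion for the derivative yields \<open>1\<close> plus an
  element of the maximal ideal.\<close>

lemma param_deriv_nonzero:
  assumes c: "c \<in> A" and l: "real l \<in> small" "l dvd p"
    and q: "coprime p q" "0 < q" "q < p"
  shows "param_deriv (real p / real q) (Suc n) c \<noteq> 0"
proof -
  define r where "r = real p / real q"
  have "r > 1"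
    using q by (simp add: r_def)
  have "coprime l q"
    using q(1) l(2) by (meson coprime_divisors dvd_refl)
  obtain p' where p': "p = p' * l"
    using l(2) by (metis dvd_div_mult_self)
  have "r = real p' * inverse (real q) * real l"
    by (simp add: r_def p' field_simps)
  then have r: "r \<in> small"
    using l(1) inverse_of_nat_mem[OF l(1) \<open>coprime l q\<close>] mult_small by blast
  define x where "x n = (power_map r c ^^ n) 0" for n
  have powr_mem: "\<bar>x n\<bar> powr (r - 1) \<in> A" for n
  proof -
    have mem: "x n \<in> A"
      unfolding x_def r_def using c q by (intro orbit_mem) auto
    have eq: "r - 1 = real (p - q) / real q"
      using q by (simp add: r_def of_nat_diff field_simps)
    show ?thesis
      unfolding eq using q by (intro abs_powr_mem mem) auto
  qed
  have small: "r * sgn (x n) * \<bar>x n\<bar> powr (r - 1) * d \<in> small" if "d \<in> A" for n d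
    using mult_small[OF mult_mem[OF mult_mem[OF sgn_mem[of "x n"] powr_mem[of n]] that] r]
    by (simp add: mult_ac)
  have "param_deriv r n c \<in> A" for n
  proof (induction n)
    case (Suc n)
    then show ?case
      unfolding param_deriv_Suc[OF \<open>r > 1\<close>] x_def[symmetric]
      by (intro add_mem one_mem small_mem[OF small])
  qed (simp add: param_deriv_0)
  then show ?thesis
    unfolding r_def[symmetric] param_deriv_Suc[OF \<open>r > 1\<close>] x_def[symmetric]
    by (intro one_plus_small(1) small)
qed

end

section \<open>Transversality at periodic parameters\<close>

theorem theorem1p1:
  fixes r c :: real and n :: nat
  assumes "r \<in> \<rat>" and "r > 1" and "periodic_pair r c n"
  shows "param_deriv r n c \<noteq> 0"
proof -
  obtain p q :: nat where "q \<noteq> 0" "\<bar>r\<bar> = real p / real q" and pq: "coprime p q"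
    using Rats_abs_nat_div_natE[OF \<open>r \<in> \<rat>\<close>] by metis
  then have r: "r = real p / real q" and q: "0 < q" "q < p"
    using \<open>r > 1\<close> by (auto simp: less_divide_eq)
  then obtain l where l: "prime l" "l dvd p"
    by (metis less_one linorder_neqE_nat not_less0 prime_factor_nat)
  obtain A :: "real set" where "valuation_ring A" and l_notin: "inverse (real l) \<notin> A"
    using valuation_ring_over_prime[OF l(1)] by metis
  then interpret real_valuation_ring A
    by (simp add: real_valuation_ring_def)
  have "real l \<in> small"
    using l_notin by (simp add: small_def)
  obtain m where m: "n = Suc m" "(power_map r c ^^ Suc m) 0 = 0"
    using assms(3) unfolding periodic_pair_def by (cases n) auto
  then have "c \<in> A"
    using orbit_escapes[OF _ q] unfolding r by blast
  then show ?thesis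
    unfolding m(1) r by (rule param_deriv_nonzero[OF _ \<open>real l \<in> small\<close> l(2) pq q])
qed

end
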